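(* Let $\mathcal G=(\mathcal V,\mathcal E)$ be a connected simple undirected graph on nodes $v_1,\dots,v_N$, let $f_1,\dots,f_N:\mathbb R\to\mathbb R$ be differentiable and strongly convex with Lipschitz continuous derivatives, and let $\rho>0$. When every edge of $\mathcal G$ is modeled as a hyperedge (so the hyperedges are exactly the edges of $\mathcal G$, each viewed as a two-element vertex set), H-CADMM reduces to D-CADMM on $\mathcal G$; that is, after $\mathbf z$ is eliminated by means of its update $\mathbf z=\mathbf E^{-1}\mathbf C^\top\mathbf x$, the H-CADMM update rules for $\mathbf x$ and $\mathbf y$ become the D-CADMM update rules.
   Context: H-CADMM: for a hypergraph with vertices $v_1,\dots,v_N$ and hyperedges $\mathcal E_1,\dots,\mathcal E_M$ (each with at least two vertices), let $\mathbf C\in\mathbb R^{N\times M}$ be the incidence matrix ($C_{ij}=1$ if $v_i\in\mathcal E_j$, else $0$), $\mathbf D$ the diagonal matrix of node degrees (number of hyperedges containing $v_i$), $\mathbf E$ the diagonal matrix with $E_{jj}=|\mathcal E_j|$. With $F(\mathbf x)=\sum_if_i(x_i)$, the update rules are: $\mathbf x^{k+1}$ is the solution of $\nabla F(\mathbf x^{k+1})+\rho\mathbf D\mathbf x^{k+1}=\rho\mathbf C\mathbf z^k-\mathbf y^k$; $\mathbf z^{k+1}=\mathbf E^{-1}\mathbf C^\top\mathbf x^{k+1}$; $\mathbf y^{k+1}=\mathbf y^k+\rho(\mathbf D\mathbf x^{k+1}-\mathbf C\mathbf z^{k+1})$. D-CADMM (decentralized consensus ADMM): with $\mathcal N_i=\{j:(v_i,v_j)\in\mathcal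 E\}$, the update rules are, for each $i$: $x_i^{k+1}$ is the solution of $f_i'(x_i^{k+1})+\rho|\mathcal N_i|x_i^{k+1}=\frac\rho2\sum_{j\in\mathcal N_i}(x_i^k+x_j^k)-y_i^k$, and $y_i^{k+1}=y_i^k+\frac\rho2\sum_{j\in\mathcal N_i}(x_i^{k+1}-x_j^{k+1})$. *)

theory Defs
  imports
    "HOL-Analysis.Derivative"
    "HOL-Analysis.Lipschitz"
    "Jordan_Normal_Form.Gauss_Jordan_Elimination"
    "Graph_Theory.Pair_Digraph"
    "Graph_Theory.Digraph_Component"
begin

unbundle no vec_syntax
unbundle no inner_syntax

text \<open>
  Vertices are \<open>0, ..., N - 1\<close>; hyperedges are listed as \<open>es ! 0, ..., es ! (M - 1)\<close> with
  \<open>M = length es\<close>. Carrier-based vectors and matrices are used so that \<open>M = 0\<close> (the connected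
  graph on a single vertex) is not excluded.
\<close>

definition hypergraph :: "nat \<Rightarrow> nat set list \<Rightarrow> bool" where
  "hypergraph N es \<longleftrightarrow> (\<forall>e \<in> set es. e \<subseteq> {..<N} \<and> 2 \<le> card e)"

definition incidence_matrix :: "nat \<Rightarrow> nat set list \<Rightarrow> real mat" where
  "incidence_matrix N es = Matrix.mat N (length es) (\<lambda>(i, j). if i \<in> es ! j then 1 else 0)"

definition node_degree_matrix :: "nat \<Rightarrow> nat set list \<Rightarrow> real mat" where
  "node_degree_matrix N es = mat_diag N (\<lambda>i. real (card {j. j < length es \<and> i \<in> es ! j}))"

definition edge_degree_matrix :: "nat set list \<Rightarrow> real mat" where
  "edge_degree_matrix es = mat_diag (length es) (\<lambda>j. real (card (es ! j)))"

definition strongly_convex :: "(real \<Rightarrow> real) \<Rightarrow> bool" where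
  "strongly_convex f \<longleftrightarrow> (\<exists>m > 0. \<forall>x y. \<forall>t \<in> {0..1}.
     f (t * x + (1 - t) * y) \<le> t * f x + (1 - t) * f y - m / 2 * t * (1 - t) * (x - y)\<^sup>2)"

definition separable_sum :: "nat \<Rightarrow> (nat \<Rightarrow> real \<Rightarrow> real) \<Rightarrow> real Matrix.vec \<Rightarrow> real" where
  "separable_sum N f x = (\<Sum>i<N. f i (x $ i))"

text \<open>
  The vector of partial derivatives; it is the gradient wherever \<open>F\<close> is differentiable
  (\<^const>\<open>deriv\<close> is unspecified elsewhere).
\<close>

definition gradient :: "(real Matrix.vec \<Rightarrow> real) \<Rightarrow> real Matrix.vec \<Rightarrow> real Matrix.vec" where
  "gradient F x = Matrix.vec (dim_vec x)
     (\<lambda>i. deriv (\<lambda>t. F (Matrix.vec (dim_vec x) (\<lambda>j. if j = i then t else x $ j))) (x $ i))"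

text \<open>\<open>x\<close> is \<^emph>\<open>the\<close> solution of \<open>P\<close>: it is a solution, and there is no other one.\<close>

definition is_the_solution :: "('a \<Rightarrow> bool) \<Rightarrow> 'a \<Rightarrow> bool" where
  "is_the_solution P x \<longleftrightarrow> P x \<and> (\<forall>w. P w \<longrightarrow> w = x)"


subsection \<open>H-CADMM\<close>

definition hcadmm_x_update ::
  "nat \<Rightarrow> nat set list \<Rightarrow> (nat \<Rightarrow> real \<Rightarrow> real) \<Rightarrow> real \<Rightarrow>
   real Matrix.vec \<Rightarrow> real Matrix.vec \<Rightarrow> real Matrix.vec \<Rightarrow> bool" where
  "hcadmm_x_update N es f \<rho> z y x' \<longleftrightarrow>
     is_the_solution
       (\<lambda>w. w \<in> carrier_vec N \<and>
            gradient (separable_sum N f) w + \<rho> \<cdot>\<^sub>v (node_degree_matrix N es *\<^sub>v w)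
              = \<rho> \<cdot>\<^sub>v (incidence_matrix N es *\<^sub>v z) - y)
       x'"

text \<open>The hyperedge degree matrix of a hypergraph is invertible, so the inverse below exists.\<close>

definition hcadmm_z_update :: "nat \<Rightarrow> nat set list \<Rightarrow> real Matrix.vec \<Rightarrow> real Matrix.vec" where
  "hcadmm_z_update N es x' =
     (the (mat_inverse (edge_degree_matrix es)) * (incidence_matrix N es)\<^sup>T) *\<^sub>v x'"

definition hcadmm_y_update ::
  "nat \<Rightarrow> nat set list \<Rightarrow> real \<Rightarrow>
   real Matrix.vec \<Rightarrow> real Matrix.vec \<Rightarrow> real Matrix.vec \<Rightarrow> real Matrix.vec" where
  "hcadmm_y_update N es \<rho> x' z' y =
     y + \<rho> \<cdot>\<^sub>v (node_degree_matrix N es *\<^sub>v x' - incidence_matrix N es *\<^sub>v z')"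

definition hcadmm_iterates ::
  "nat \<Rightarrow> nat set list \<Rightarrow> (nat \<Rightarrow> real \<Rightarrow> real) \<Rightarrow> real \<Rightarrow>
   (nat \<Rightarrow> real Matrix.vec) \<Rightarrow> (nat \<Rightarrow> real Matrix.vec) \<Rightarrow> (nat \<Rightarrow> real Matrix.vec) \<Rightarrow> bool" where
  "hcadmm_iterates N es f \<rho> x z y \<longleftrightarrow> (\<forall>k.
     hcadmm_x_update N es f \<rho> (z k) (y k) (x (Suc k)) \<and>
     z (Suc k) = hcadmm_z_update N es (x (Suc k)) \<and>
     y (Suc k) = hcadmm_y_update N es \<rho> (x (Suc k)) (z (Suc k)) (y k))"


subsection \<open>D-CADMM\<close>

text \<open>Simple undirected graphs are symmetric loop-free sets of vertex pairs (\<^locale>\<open>pair_graph\<close>).\<close>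

definition neighbours :: "nat pair_pre_digraph \<Rightarrow> nat \<Rightarrow> nat set" where
  "neighbours G i = {j. (i, j) \<in> parcs G}"

definition dcadmm_x_update ::
  "nat \<Rightarrow> nat pair_pre_digraph \<Rightarrow> (nat \<Rightarrow> real \<Rightarrow> real) \<Rightarrow> real \<Rightarrow>
   real Matrix.vec \<Rightarrow> real Matrix.vec \<Rightarrow> real Matrix.vec \<Rightarrow> bool" where
  "dcadmm_x_update N G f \<rho> x y x' \<longleftrightarrow>
     x' \<in> carrier_vec N \<and>
     (\<forall>i<N. is_the_solution
       (\<lambda>t. deriv (f i) t + \<rho> * real (card (neighbours G i)) * t
              = \<rho> / 2 * (\<Sum>j\<in>neighbours G i. x $ i + x $ j) - y $ i)
       (x' $ i))"

definition dcadmm_y_update ::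
  "nat \<Rightarrow> nat pair_pre_digraph \<Rightarrow> real \<Rightarrow>
   real Matrix.vec \<Rightarrow> real Matrix.vec \<Rightarrow> real Matrix.vec" where
  "dcadmm_y_update N G \<rho> x' y =
     Matrix.vec N (\<lambda>i. y $ i + \<rho> / 2 * (\<Sum>j\<in>neighbours G i. x' $ i - x' $ j))"

definition dcadmm_iterates ::
  "nat \<Rightarrow> nat pair_pre_digraph \<Rightarrow> (nat \<Rightarrow> real \<Rightarrow> real) \<Rightarrow> real \<Rightarrow>
   (nat \<Rightarrow> real Matrix.vec) \<Rightarrow> (nat \<Rightarrow> real Matrix.vec) \<Rightarrow> bool" where
  "dcadmm_iterates N G f \<rho> x y \<longleftrightarrow> (\<forall>k.
     dcadmm_x_update N G f \<rho> (x k) (y k) (x (Suc k)) \<and>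
     y (Suc k) = dcadmm_y_update N G \<rho> (x (Suc k)) (y k))"


subsection \<open>The edges of a graph as hyperedges\<close>

text \<open>The numbering of the edges is arbitrary, but each edge is listed exactly once.\<close>

definition edges_as_hyperedges :: "nat pair_pre_digraph \<Rightarrow> nat set list \<Rightarrow> bool" where
  "edges_as_hyperedges G es \<longleftrightarrow> distinct es \<and> set es = {{u, v} | u v. (u, v) \<in> parcs G}"

lemma edges_as_hyperedges_hypergraph:
  assumes "pair_graph G" and "pverts G = {..<N}" and "edges_as_hyperedges G es"
  shows "hypergraph N es" and "\<forall>e \<in> set es. card e = 2"
proof -
  interpret pair_graph G by fact
  have *: "e \<subseteq> {..<N} \<and> card e = 2" if e: "e \<in> set es" for e
  proof -
    obtain u v where uv: "e = {u, v}" "(u, v) \<in> parcs G"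
      using e assms(3) by (auto simp: edges_as_hyperedges_def)
    have "u \<noteq> v" using pair_no_loops[OF uv(2)] by simp
    moreover have "u \<in> pverts G" "v \<in> pverts G" using wellformed'[OF uv(2)] by auto
    ultimately show ?thesis using uv(1) assms(2) by auto
  qed
  show "hypergraph N es" and "\<forall>e \<in> set es. card e = 2"
    using * by (auto simp: hypergraph_def)
qed

end

theory Submission
  imports Defs
begin

text \<open>
  The hyperedges containing \<open>i\<close> are the sets \<open>{i, j}\<close> with \<open>j\<close> a neighbour of \<open>i\<close>, and the z-update
  puts the average of \<open>x\<close> over its endpoints on each edge. Hence the \<open>i\<close>-th entry of \<open>C z\<close> is half the
  sum of \<open>x $ i + x $ j\<close> over the neighbours \<open>j\<close>, and the gradient being separable, the x-equation
  splits into the scalar D-CADMM equations.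
\<close>

section \<open>Diagonal matrices, the incidence matrix and the z-update\<close>

text \<open>Only the specification of \<open>mat_inverse\<close> is used, not its computation:
  \<open>None\<close> would deny that the matrix is a unit, which the diagonal of reciprocals
  refutes, and a returned matrix is a right inverse, hence equal to that diagonal.\<close>

lemma mat_inverse_mat_diag:
  fixes d :: "nat \<Rightarrow> 'a::field"
  assumes "\<And>j. j < n \<Longrightarrow> d j \<noteq> 0"
  shows "mat_inverse (mat_diag n d) = Some (mat_diag n (\<lambda>j. inverse (d j)))"
proof -
  let ?A = "mat_diag n d" and ?B = "mat_diag n (\<lambda>j. inverse (d j))"
  have carr: "?A \<in> carrier_mat n n" "?B \<in> carrier_mat n n" by simp_all
  have AB: "?A * ?B = 1\<^sub>m n" and BA: "?B * ?A = 1\<^sub>m n"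
    unfolding mat_diag_diag using assms by (auto simp: mat_diag_def)
  show ?thesis
  proof (cases "mat_inverse ?A")
    case None
    have "?A \<in> Units (ring_mat TYPE('a) n ())"
      unfolding Units_def ring_mat_def using carr AB BA by (intro CollectI conjI bexI[of _ ?B]) simp_all
    with mat_inverse(1)[OF carr(1) None, where b = "()"] show ?thesis by blast
  next
    case (Some B')
    from mat_inverse(2)[OF carr(1) Some] have "?A * B' = 1\<^sub>m n" and "B' \<in> carrier_mat n n"
      by simp_all
    \<comment> \<open>Uniqueness of inverses: the product regroups as \<open>(?B * ?A) * B'\<close>,
      while its second factor is the identity.\<close>
    then have "B' = ?B * (?A * B')"
      using carr BA assoc_mult_mat[OF carr(2,1), of B' n] by simp
    with \<open>?A * B' = 1\<^sub>m n\<close> right_mult_one_mat[OF carr(2)] Some show ?thesis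
      by (simp only:)
  qed
qed

lemma mat_diag_mult_vec:
  fixes v :: "'a::semiring_0 Matrix.vec"
  assumes "v \<in> carrier_vec n"
  shows "mat_diag n d *\<^sub>v v = Matrix.vec n (\<lambda>i. d i * v $ i)"
  using assms
  by (auto intro!: eq_vecI simp: mat_diag_def scalar_prod_def if_distrib[of "\<lambda>x. x * _"] sum.delta cong: if_cong)

lemma incidence_matrix_carrier: "incidence_matrix N es \<in> carrier_mat N (length es)"
  by (simp add: incidence_matrix_def)

lemma incidence_matrix_mult_vec:
  assumes "z \<in> carrier_vec (length es)"
  shows "incidence_matrix N es *\<^sub>v z
    = Matrix.vec N (\<lambda>i. \<Sum>j | j < length es \<and> i \<in> es ! j. z $ j)"
proof (rule eq_vecI)
  fix i assume "i < dim_vec (Matrix.vec N (\<lambda>i. \<Sum>j | j < length es \<and> i \<in> es ! j. z $ j))"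
  then have i: "i < N" by simp
  have "(incidence_matrix N es *\<^sub>v z) $ i
      = (\<Sum>j = 0..<length es. if i \<in> es ! j then z $ j else 0)"
    using i assms by (auto simp: incidence_matrix_def scalar_prod_def intro!: sum.cong)
  also have "\<dots> = (\<Sum>j | j < length es \<and> i \<in> es ! j. z $ j)"
    by (subst sum.inter_filter[symmetric]) (auto intro!: sum.cong)
  finally show "(incidence_matrix N es *\<^sub>v z) $ i
      = Matrix.vec N (\<lambda>i. \<Sum>j | j < length es \<and> i \<in> es ! j. z $ j) $ i"
    using i by simp
qed (simp add: incidence_matrix_def)

text \<open>The transposed incidence matrix sums \<open>x\<close> over each hyperedge; the inverse
  degree matrix then divides by the size, which is nonzero because a hyperedge has at least two
  vertices.\<close>

lemma hcadmm_z_update_eq_average: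
  assumes "hypergraph N es" and x: "x \<in> carrier_vec N"
  shows "hcadmm_z_update N es x
    = Matrix.vec (length es) (\<lambda>j. (\<Sum>i\<in>es ! j. x $ i) / real (card (es ! j)))"
proof -
  have sub: "es ! j \<subseteq> {..<N}" and card: "real (card (es ! j)) \<noteq> 0" if "j < length es" for j
    using assms(1) nth_mem[OF that] unfolding hypergraph_def by fastforce+
  have Ct: "(incidence_matrix N es)\<^sup>T *\<^sub>v x = Matrix.vec (length es) (\<lambda>j. \<Sum>i\<in>es ! j. x $ i)"
  proof (rule eq_vecI)
    fix j assume "j < dim_vec (Matrix.vec (length es) (\<lambda>j. \<Sum>i\<in>es ! j. x $ i))"
    then have j: "j < length es" by simp
    have "((incidence_matrix N es)\<^sup>T *\<^sub>v x) $ j = (\<Sum>i = 0..<N. if i \<in> es ! j then x $ i else 0)"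
      using j x by (auto simp: incidence_matrix_def scalar_prod_def intro!: sum.cong)
    \<comment> \<open>Hyperedges lie inside \<open>{..<N}\<close>, so restricting the index range to
      \<open>es ! j\<close> loses no vertex.\<close>
    also have "\<dots> = (\<Sum>i\<in>es ! j. x $ i)"
      using sub[OF j] by (subst sum.inter_filter[symmetric]) (auto intro!: sum.cong)
    finally show "((incidence_matrix N es)\<^sup>T *\<^sub>v x) $ j
        = Matrix.vec (length es) (\<lambda>j. \<Sum>i\<in>es ! j. x $ i) $ j"
      using j by simp
  qed (simp add: incidence_matrix_def)
  have inv: "mat_inverse (mat_diag (length es) (\<lambda>j. real (card (es ! j))))
      = Some (mat_diag (length es) (\<lambda>j. inverse (real (card (es ! j)))))"
    by (rule mat_inverse_mat_diag) (rule card)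
  have "hcadmm_z_update N es x
      = mat_diag (length es) (\<lambda>j. inverse (real (card (es ! j)))) *\<^sub>v ((incidence_matrix N es)\<^sup>T *\<^sub>v x)"
    unfolding hcadmm_z_update_def edge_degree_matrix_def inv option.sel
    using x by (intro assoc_mult_mat_vec[OF mat_diag_dim, where ?n\<^sub>3.0 = N])
      (simp_all add: incidence_matrix_carrier)
  also have "\<dots> = Matrix.vec (length es) (\<lambda>j. (\<Sum>i\<in>es ! j. x $ i) / real (card (es ! j)))"
    unfolding Ct by (subst mat_diag_mult_vec) (auto intro!: eq_vecI simp: field_simps)
  finally show ?thesis .
qed

section \<open>Incident edges and neighbours\<close>

text \<open>Two bijections compose: list positions to edges, as no edge is listed twice, and
  neighbours \<open>j\<close> to edges \<open>{i, j}\<close>. Taking \<open>g\<close> constant gives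
  the degrees; taking \<open>g\<close> to be the average over an edge gives the entries of C
  z.\<close>

lemma sum_incident_edges:
  assumes "pair_graph G" and es: "edges_as_hyperedges G es"
  shows "(\<Sum>j | j < length es \<and> i \<in> es ! j. g (es ! j)) = (\<Sum>j\<in>neighbours G i. g {i, j})"
proof -
  interpret pair_graph G by fact
  have dist: "distinct es" and set: "set es = {{u, v} | u v. (u, v) \<in> parcs G}"
    using es by (auto simp: edges_as_hyperedges_def)
  have "(\<Sum>j | j < length es \<and> i \<in> es ! j. g (es ! j)) = (\<Sum>e | e \<in> set es \<and> i \<in> e. g e)"
  proof (rule sum.reindex_bij_betw)
    show "bij_betw ((!) es) {j. j < length es \<and> i \<in> es ! j} {e. e \<in> set es \<and> i \<in> e}"
      using dist by (auto simp: bij_betw_def inj_on_def nth_eq_iff_index_eq in_set_conv_nth)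
  qed
  also have "\<dots> = (\<Sum>j\<in>neighbours G i. g {i, j})"
  proof (rule sum.reindex_bij_betw[symmetric])
    \<comment> \<open>An edge containing \<open>i\<close> may come from an arc ending in
      \<open>i\<close>; the reversed arc shows that its other endpoint is a neighbour.\<close>
    have sym: "(v, u) \<in> parcs G" if "(u, v) \<in> parcs G" for u v
      using that arcs_symmetric by blast
    have "inj_on (\<lambda>j. {i, j}) (neighbours G i)"
      by (auto simp: inj_on_def doubleton_eq_iff)
    moreover have "(\<lambda>j. {i, j}) ` neighbours G i = {e. e \<in> set es \<and> i \<in> e}"
      unfolding set neighbours_def using sym by (auto simp: image_iff)
    ultimately show "bij_betw (\<lambda>j. {i, j}) (neighbours G i) {e. e \<in> set es \<and> i \<in> e}"
      by (simp add: bij_betw_def)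
  qed
  finally show ?thesis .
qed

lemma node_degree_eq_card_neighbours:
  assumes "pair_graph G" and "edges_as_hyperedges G es"
  shows "card {j. j < length es \<and> i \<in> es ! j} = card (neighbours G i)"
  using sum_incident_edges[OF assms, of "\<lambda>_. 1 :: nat" i] by simp

lemma node_degree_matrix_mult_vec:
  assumes "pair_graph G" and "edges_as_hyperedges G es" and "w \<in> carrier_vec N"
  shows "node_degree_matrix N es *\<^sub>v w
    = Matrix.vec N (\<lambda>i. real (card (neighbours G i)) * w $ i)"
  using assms by (simp add: node_degree_matrix_def mat_diag_mult_vec node_degree_eq_card_neighbours)

lemma incidence_matrix_mult_z_update:
  assumes G: "pair_graph G" "pverts G = {..<N}" "edges_as_hyperedges G es"
    and x: "x \<in> carrier_vec N"
  shows "incidence_matrix N es *\<^sub>v hcadmm_z_update N es x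
    = Matrix.vec N (\<lambda>i. (\<Sum>j\<in>neighbours G i. x $ i + x $ j) / 2)"
proof (rule eq_vecI)
  interpret pair_graph G by fact
  note hyp = edges_as_hyperedges_hypergraph[OF G]
  let ?avg = "\<lambda>e. (\<Sum>l\<in>e. x $ l) / real (card e)"
  fix i assume "i < dim_vec (Matrix.vec N (\<lambda>i. (\<Sum>j\<in>neighbours G i. x $ i + x $ j) / 2))"
  then have i: "i < N" by simp
  have "(incidence_matrix N es *\<^sub>v hcadmm_z_update N es x) $ i
      = (\<Sum>j | j < length es \<and> i \<in> es ! j. ?avg (es ! j))"
    using i x hyp(1) by (simp add: hcadmm_z_update_eq_average incidence_matrix_mult_vec)
  also have "\<dots> = (\<Sum>j\<in>neighbours G i. ?avg {i, j})"
    by (rule sum_incident_edges[OF G(1,3)])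
  also have "\<dots> = (\<Sum>j\<in>neighbours G i. (x $ i + x $ j) / 2)"
  proof (rule sum.cong)
    fix j assume "j \<in> neighbours G i"
    \<comment> \<open>Without loops \<open>{i, j}\<close> has exactly two elements; this is where
      the factor 1/2 of D-CADMM arises.\<close>
    then have "i \<noteq> j" using pair_no_loops[of "(i, j)"] by (auto simp: neighbours_def)
    then show "?avg {i, j} = (x $ i + x $ j) / 2" by simp
  qed simp
  finally show "(incidence_matrix N es *\<^sub>v hcadmm_z_update N es x) $ i
      = Matrix.vec N (\<lambda>i. (\<Sum>j\<in>neighbours G i. x $ i + x $ j) / 2) $ i"
    using i by (simp add: sum_divide_distrib)
qed (simp add: incidence_matrix_def)

section \<open>Splitting the x-equation into coordinates\<close>

text \<open>Varying coordinate \<open>i\<close> alone changes only the \<open>i\<close>-th summand;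
  the others form a constant, and differentiability of \<open>f i\<close> lets it drop out of
  \<open>deriv\<close>.\<close>

lemma gradient_separable_sum:
  assumes w: "w \<in> carrier_vec N" and f: "\<And>i. i < N \<Longrightarrow> f i differentiable_on UNIV"
  shows "gradient (separable_sum N f) w = Matrix.vec N (\<lambda>i. deriv (f i) (w $ i))"
proof (rule eq_vecI)
  fix i assume "i < dim_vec (Matrix.vec N (\<lambda>i. deriv (f i) (w $ i)))"
  then have i: "i < N" by simp
  have "separable_sum N f (Matrix.vec N (\<lambda>j. if j = i then t else w $ j))
      = f i t + (\<Sum>j\<in>{..<N} - {i}. f j (w $ j))" for t
    using i unfolding separable_sum_def
    by (subst sum.remove[of _ i]) (auto intro!: sum.cong)
  moreover have "(f i has_field_derivative deriv (f i) (w $ i)) (at (w $ i))"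
    using f[OF i] by (simp add: differentiable_on_def DERIV_deriv_iff_real_differentiable)
  then have "deriv (\<lambda>t. f i t + (\<Sum>j\<in>{..<N} - {i}. f j (w $ j))) (w $ i) = deriv (f i) (w $ i)"
    by (intro DERIV_imp_deriv) (auto intro!: derivative_eq_intros)
  ultimately show "gradient (separable_sum N f) w $ i
      = Matrix.vec N (\<lambda>i. deriv (f i) (w $ i)) $ i"
    using i w by (simp add: gradient_def)
qed (use w in \<open>simp add: gradient_def\<close>)

text \<open>
  A second solution of one coordinate equation gives a second solution of the system by changing
  that coordinate only, so joint uniqueness implies coordinatewise uniqueness.
\<close>

lemma is_the_solution_componentwise:
  "is_the_solution (\<lambda>w. w \<in> carrier_vec N \<and> (\<forall>i<N. P i (w $ i))) x
    \<longleftrightarrow> x \<in> carrier_vec N \<and> (\<forall>i<N. is_the_solution (P i) (x $ i))"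
proof
  assume sol: "is_the_solution (\<lambda>w. w \<in> carrier_vec N \<and> (\<forall>i<N. P i (w $ i))) x"
  then have x: "x \<in> carrier_vec N" and Px: "\<And>i. i < N \<Longrightarrow> P i (x $ i)"
    and uniq: "\<And>w. w \<in> carrier_vec N \<Longrightarrow> \<forall>i<N. P i (w $ i) \<Longrightarrow> w = x"
    by (auto simp: is_the_solution_def)
  have "t = x $ i" if i: "i < N" and t: "P i t" for i t
  proof -
    let ?w = "Matrix.vec N (\<lambda>j. if j = i then t else x $ j)"
    have "?w = x" by (rule uniq) (use Px t in auto)
    moreover have "?w $ i = t" using i by simp
    ultimately show ?thesis by simp
  qed
  with x Px show "x \<in> carrier_vec N \<and> (\<forall>i<N. is_the_solution (P i) (x $ i))"
    by (simp add: is_the_solution_def)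
next
  assume "x \<in> carrier_vec N \<and> (\<forall>i<N. is_the_solution (P i) (x $ i))"
  then show "is_the_solution (\<lambda>w. w \<in> carrier_vec N \<and> (\<forall>i<N. P i (w $ i))) x"
    by (auto simp: is_the_solution_def intro!: eq_vecI)
qed

section \<open>Comparison of the update rules and of the iterations\<close>

lemma hcadmm_x_update_iff_dcadmm_x_update:
  assumes G: "pair_graph G" "pverts G = {..<N}" "edges_as_hyperedges G es"
    and f: "\<And>i. i < N \<Longrightarrow> f i differentiable_on UNIV"
    and x: "x \<in> carrier_vec N" and y: "y \<in> carrier_vec N"
  shows "hcadmm_x_update N es f \<rho> (hcadmm_z_update N es x) y x' \<longleftrightarrow> dcadmm_x_update N G f \<rho> x y x'"
proof -
  let ?P = "\<lambda>i t. deriv (f i) t + \<rho> * real (card (neighbours G i)) * t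
    = \<rho> / 2 * (\<Sum>j\<in>neighbours G i. x $ i + x $ j) - y $ i"
  have sys: "gradient (separable_sum N f) w + \<rho> \<cdot>\<^sub>v (node_degree_matrix N es *\<^sub>v w)
        = \<rho> \<cdot>\<^sub>v (incidence_matrix N es *\<^sub>v hcadmm_z_update N es x) - y
      \<longleftrightarrow> (\<forall>i<N. ?P i (w $ i))" if "w \<in> carrier_vec N" for w
  proof -
    have "gradient (separable_sum N f) w + \<rho> \<cdot>\<^sub>v (node_degree_matrix N es *\<^sub>v w)
        = Matrix.vec N (\<lambda>i. deriv (f i) (w $ i) + \<rho> * real (card (neighbours G i)) * w $ i)"
      by (rule eq_vecI) (simp_all add: gradient_separable_sum[OF that f]
          node_degree_matrix_mult_vec[OF G(1,3) that])
    moreover have "\<rho> \<cdot>\<^sub>v (incidence_matrix N es *\<^sub>v hcadmm_z_update N es x) - y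
        = Matrix.vec N (\<lambda>i. \<rho> / 2 * (\<Sum>j\<in>neighbours G i. x $ i + x $ j) - y $ i)"
      using y by (intro eq_vecI) (simp_all add: incidence_matrix_mult_z_update[OF G x])
    ultimately show ?thesis by (auto simp only: vec_eq_iff dim_vec index_vec)
  qed
  \<comment> \<open>The two predicates are identified as functions, since
    \<open>is_the_solution\<close> also quantifies over all competing candidates.\<close>
  have "(\<lambda>w. w \<in> carrier_vec N \<and>
        gradient (separable_sum N f) w + \<rho> \<cdot>\<^sub>v (node_degree_matrix N es *\<^sub>v w)
          = \<rho> \<cdot>\<^sub>v (incidence_matrix N es *\<^sub>v hcadmm_z_update N es x) - y)
      = (\<lambda>w. w \<in> carrier_vec N \<and> (\<forall>i<N. ?P i (w $ i)))"
    by (intro ext conj_cong refl) (rule sys)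
  then show ?thesis
    using is_the_solution_componentwise[of N ?P x']
    by (simp only: hcadmm_x_update_def dcadmm_x_update_def)
qed

text \<open>With d neighbours, d times \<open>x $ i\<close> minus half the sum of
  \<open>x $ i + x $ j\<close> is half the sum of \<open>x $ i - x $ j\<close>.\<close>

lemma hcadmm_y_update_eq_dcadmm_y_update:
  assumes G: "pair_graph G" "pverts G = {..<N}" "edges_as_hyperedges G es"
    and x: "x \<in> carrier_vec N" and y: "y \<in> carrier_vec N"
  shows "hcadmm_y_update N es \<rho> x (hcadmm_z_update N es x) y = dcadmm_y_update N G \<rho> x y"
  using y unfolding hcadmm_y_update_def dcadmm_y_update_def
    node_degree_matrix_mult_vec[OF G(1,3) x] incidence_matrix_mult_z_update[OF G x]
  by (auto intro!: eq_vecI simp: sum.distrib sum_subtractf field_simps)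

text \<open>The first two conjuncts eliminate z within one step, the third along whole runs. There
  \<open>z 0\<close> is tied to \<open>x 0\<close>, because the first x-update reads
  \<open>z 0\<close> and no z-update produces it.\<close>

theorem proposition2:
  fixes N :: nat and G :: "nat pair_pre_digraph" and es :: "nat set list"
    and f :: "nat \<Rightarrow> real \<Rightarrow> real" and \<rho> :: real
  assumes "pair_graph G"
    and "pverts G = {..<N}"
    and "Digraph_Component.connected (with_proj G)"
    and "edges_as_hyperedges G es"
    and "\<And>i. i < N \<Longrightarrow> f i differentiable_on UNIV"
    and "\<And>i. i < N \<Longrightarrow> strongly_convex (f i)"
    and "\<And>i. i < N \<Longrightarrow> \<exists>L. lipschitz_on L UNIV (deriv (f i))"
    and "\<rho> > 0"
  shows "(\<forall>x \<in> carrier_vec N. \<forall>y \<in> carrier_vec N. \<forall>x'.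
            hcadmm_x_update N es f \<rho> (hcadmm_z_update N es x) y x'
              \<longleftrightarrow> dcadmm_x_update N G f \<rho> x y x')
       \<and> (\<forall>x' \<in> carrier_vec N. \<forall>y \<in> carrier_vec N.
            hcadmm_y_update N es \<rho> x' (hcadmm_z_update N es x') y = dcadmm_y_update N G \<rho> x' y)
       \<and> (\<forall>x z y. x 0 \<in> carrier_vec N \<longrightarrow> y 0 \<in> carrier_vec N \<longrightarrow>
            z 0 = hcadmm_z_update N es (x 0) \<longrightarrow>
            (hcadmm_iterates N es f \<rho> x z y
              \<longleftrightarrow> dcadmm_iterates N G f \<rho> x y \<and> (\<forall>k. z k = hcadmm_z_update N es (x k))))"
proof -
  note G = assms(1,2,4)
  have X: "hcadmm_x_update N es f \<rho> (hcadmm_z_update N es x) y x' \<longleftrightarrow> dcadmm_x_update N G f \<rho> x y x'"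
    if "x \<in> carrier_vec N" "y \<in> carrier_vec N" for x y x'
    using hcadmm_x_update_iff_dcadmm_x_update[OF G assms(5) that] .
  have Y: "hcadmm_y_update N es \<rho> x' (hcadmm_z_update N es x') y = dcadmm_y_update N G \<rho> x' y"
    if "x' \<in> carrier_vec N" "y \<in> carrier_vec N" for x' y
    using hcadmm_y_update_eq_dcadmm_y_update[OF G that] .
  have "hcadmm_iterates N es f \<rho> x z y
      \<longleftrightarrow> dcadmm_iterates N G f \<rho> x y \<and> (\<forall>k. z k = hcadmm_z_update N es (x k))"
    if x0: "x 0 \<in> carrier_vec N" and y0: "y 0 \<in> carrier_vec N"
      and z0: "z 0 = hcadmm_z_update N es (x 0)" for x z y
  proof
    assume H: "hcadmm_iterates N es f \<rho> x z y"
    have x: "x k \<in> carrier_vec N" for k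
      using x0 H by (cases k)
        (auto simp: hcadmm_iterates_def hcadmm_x_update_def is_the_solution_def)
    have z: "z k = hcadmm_z_update N es (x k)" for k
      using z0 H by (cases k) (auto simp: hcadmm_iterates_def)
    \<comment> \<open>Induction, because \<open>Y\<close>, which turns the update into a
      \<open>Matrix.vec N\<close>, applies only once \<open>y k\<close> is known to have dimension
      \<open>N\<close>.\<close>
    have y: "y k \<in> carrier_vec N" for k
    proof (induction k)
      case (Suc k)
      have "y (Suc k) = hcadmm_y_update N es \<rho> (x (Suc k)) (hcadmm_z_update N es (x (Suc k))) (y k)"
        using H by (simp add: hcadmm_iterates_def flip: z)
      with Y[OF x Suc] show ?case by (simp add: dcadmm_y_update_def)
    qed (rule y0)
    show "dcadmm_iterates N G f \<rho> x y \<and> (\<forall>k. z k = hcadmm_z_update N es (x k))"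
      using H X[OF x y] Y[OF x y] by (simp add: hcadmm_iterates_def dcadmm_iterates_def z)
  next
    assume D: "dcadmm_iterates N G f \<rho> x y \<and> (\<forall>k. z k = hcadmm_z_update N es (x k))"
    have x: "x k \<in> carrier_vec N" for k
      using x0 D by (cases k) (auto simp: dcadmm_iterates_def dcadmm_x_update_def)
    \<comment> \<open>Here a case distinction suffices: the D-CADMM update builds a vector of
      dimension \<open>N\<close> whatever \<open>y k\<close> is.\<close>
    have y: "y k \<in> carrier_vec N" for k
      using y0 D by (cases k) (auto simp: dcadmm_iterates_def dcadmm_y_update_def)
    show "hcadmm_iterates N es f \<rho> x z y"
      using D X[OF x y] Y[OF x y] by (simp add: hcadmm_iterates_def dcadmm_iterates_def)
  qed
  with X Y show ?thesis by blast
qed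

end
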